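(* Let $n\ge 1$, let $\mathbf{x}=(x_0,x_1,\dots,x_n)\in\mathcal{X}^{n+1}$ be any sequence of contexts, let $\pi$ be any non-decreasing separable policy, and let $\mu_0\in[0,1]$. Then $$\sup_{\substack{\mu_1,\dots,\mu_n\in[0,1]\\ |\mu_i-\mu_0|\le d(x_0,x_i)\ \forall i\in\{1,\dots,n\}}}\mathbb{E}_{\mathbf{y}\sim\mathcal{B}(\mu_1)\times\cdots\times\mathcal{B}(\mu_n)}\big[R(\pi(\mathbf{x},\mathbf{y}),\mathcal{B}(\mu_0))\big]$$ is equal to $$\mathbb{E}_{\mathbf{y}\sim\mathcal{B}(\mu_0+d(x_0,x_1))\times\cdots\times\mathcal{B}(\mu_0+d(x_0,x_n))}\big[R(\pi(\mathbf{x},\mathbf{y}),\mathcal{B}(\mu_0))\big]\quad\text{if }\mu_0\in[0,1-q],$$ and to $$\mathbb{E}_{\mathbf{y}\sim\mathcal{B}(\mu_0-d(x_0,x_1))\times\cdots\times\mathcal{B}(\mu_0-d(x_0,x_n))}\big[R(\pi(\mathbf{x},\mathbf{y}),\mathcal{B}(\mu_0))\big]\quad\text{if }\mu_0\in[1-q,1].$$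
   Context: Let $\mathcal{Y}=[0,1]$ and let $\Delta(\mathcal{Y})$ be the set of probability distributions on $\mathcal{Y}$; an element $F\in\Delta(\mathcal{Y})$ is identified with its cumulative distribution function (cdf). Let $\mathcal{X}$ be a set (of contexts) and $d:\mathcal{X}\times\mathcal{X}\to\mathbb{R}$ a non-negative function (the dissimilarity). Costs $c_o,c_u>0$ satisfy $c_o+c_u=1$, and $q=c_u/(c_u+c_o)$. Newsvendor loss: $\ell(a,y)=c_o(a-y)^+ + c_u(y-a)^+$ for $a,y\in\mathcal{Y}$, where $z^+=\max(0,z)$. For $a\in\mathcal{Y}$, $F_0\in\Delta(\mathcal{Y})$: $L(a,F_0)=\mathbb{E}_{y\sim F_0}[\ell(a,y)]$, $a^*_{F_0}=\inf\{a\in\mathcal{Y}: F_0(a)\ge q\}$, $R(a,F_0)=L(a,F_0)-L(a^*_{F_0},F_0)$. For $\nu\in\Delta(\mathcal{Y})$: $L(\nu,F_0)=\mathbb{E}_{a\sim\nu}[L(a,F_0)]$ and $R(\nu,F_0)=L(\nu,F_0)-L(a^*_{F_0},F_0)$. A data-driven policy (possibly randomized) is a map $\pi:\mathcal{X}^{n+1}\times\mathcal{Y}^n\to\Delta(\mathcal{Y})$, measurable in $\mathbf{y}$ so that all expectations below make sense. The contexts $\mathbf{x}$ are fixed. Separable policy: $\pi$ is separable if there is a function $P^\pi:[0,1]^n\to[0,1]$ (possibly depending on the fixed $\mathbf{x}$) such that for all $F_1,\dots,F_n\in\Delta(\mathcal{Y})$ and all $y\in\mathbb{R}$, $$\mathbb{P}_{\mathbf{y}\sim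 F_1\times\cdots\times F_n,\ a\sim\pi(\mathbf{x},\mathbf{y})}(a\le y)=P^\pi(F_1(y),\dots,F_n(y)).$$ It is non-decreasing separable if in addition $P^\pi$ is non-decreasing in each coordinate (the other coordinates being fixed in $[0,1]$). For $\mu\in\mathbb{R}$, $\mathcal{B}(\mu)$ denotes the Bernoulli distribution on $\{0,1\}$ with mean $\min(\max(\mu,0),1)$. *)

theory Defs
  imports "HOL-Probability.Probability"
begin

definition outcome_space :: "real measure" where
  "outcome_space = restrict_space borel {0..1}"

definition distributions :: "real measure set" where
  "distributions = space (prob_algebra outcome_space)"

(* The library constant cdf is meant for measures on the whole real line: for F on the
   outcome space, {..y} need not be a measurable set, so it is cut down to the space of F. *)
definition dist_cdf :: "real measure \<Rightarrow> real \<Rightarrow> real" where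
  "dist_cdf F y = \<P>(a in F. a \<le> y)"

definition critical_ratio :: "real \<Rightarrow> real \<Rightarrow> real" where
  "critical_ratio c\<^sub>o c\<^sub>u = c\<^sub>u / (c\<^sub>u + c\<^sub>o)"

definition newsvendor_loss :: "real \<Rightarrow> real \<Rightarrow> real \<Rightarrow> real \<Rightarrow> real" where
  "newsvendor_loss c\<^sub>o c\<^sub>u a y = c\<^sub>o * max 0 (a - y) + c\<^sub>u * max 0 (y - a)"

definition expected_loss :: "real \<Rightarrow> real \<Rightarrow> real \<Rightarrow> real measure \<Rightarrow> real" where
  "expected_loss c\<^sub>o c\<^sub>u a F = (LINT y|F. newsvendor_loss c\<^sub>o c\<^sub>u a y)"

definition optimal_action :: "real \<Rightarrow> real \<Rightarrow> real measure \<Rightarrow> real" where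
  "optimal_action c\<^sub>o c\<^sub>u F = Inf {a \<in> {0..1}. dist_cdf F a \<ge> critical_ratio c\<^sub>o c\<^sub>u}"

definition randomized_loss :: "real \<Rightarrow> real \<Rightarrow> real measure \<Rightarrow> real measure \<Rightarrow> real" where
  "randomized_loss c\<^sub>o c\<^sub>u \<nu> F = (LINT a|\<nu>. expected_loss c\<^sub>o c\<^sub>u a F)"

definition regret :: "real \<Rightarrow> real \<Rightarrow> real measure \<Rightarrow> real measure \<Rightarrow> real" where
  "regret c\<^sub>o c\<^sub>u \<nu> F =
     randomized_loss c\<^sub>o c\<^sub>u \<nu> F - expected_loss c\<^sub>o c\<^sub>u (optimal_action c\<^sub>o c\<^sub>u F) F"

(* Contexts x_0, ..., x_n and outcomes y_1, ..., y_n are extensional functions on {0..n} and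
   {1..n}; measurability in y makes every policy a probability kernel. *)
definition policy :: "nat \<Rightarrow> ((nat \<Rightarrow> 'x) \<Rightarrow> (nat \<Rightarrow> real) \<Rightarrow> real measure) \<Rightarrow> bool" where
  "policy n \<pi> \<longleftrightarrow> (\<forall>x \<in> {0..n} \<rightarrow>\<^sub>E UNIV.
     \<pi> x \<in> (\<Pi>\<^sub>M i\<in>{1..n}. outcome_space) \<rightarrow>\<^sub>M prob_algebra outcome_space)"

(* The law of the action a when y is drawn from the product of the F_i and then a from \<pi>(x, y). *)
definition action_law ::
  "nat \<Rightarrow> ((nat \<Rightarrow> 'x) \<Rightarrow> (nat \<Rightarrow> real) \<Rightarrow> real measure) \<Rightarrow> (nat \<Rightarrow> 'x)
    \<Rightarrow> (nat \<Rightarrow> real measure) \<Rightarrow> real measure" where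
  "action_law n \<pi> x F = (\<Pi>\<^sub>M i\<in>{1..n}. F i) \<bind> \<pi> x"

definition separable_via ::
  "nat \<Rightarrow> ((nat \<Rightarrow> 'x) \<Rightarrow> (nat \<Rightarrow> real) \<Rightarrow> real measure) \<Rightarrow> (nat \<Rightarrow> 'x)
    \<Rightarrow> ((nat \<Rightarrow> real) \<Rightarrow> real) \<Rightarrow> bool" where
  "separable_via n \<pi> x P \<longleftrightarrow>
     P \<in> ({1..n} \<rightarrow>\<^sub>E {0..1}) \<rightarrow> {0..1} \<and>
     (\<forall>F \<in> {1..n} \<rightarrow>\<^sub>E distributions. \<forall>y.
        dist_cdf (action_law n \<pi> x F) y = P (\<lambda>i\<in>{1..n}. dist_cdf (F i) y))"

definition nondecreasing_coordinatewise :: "nat \<Rightarrow> ((nat \<Rightarrow> real) \<Rightarrow> real) \<Rightarrow> bool" where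
  "nondecreasing_coordinatewise n P \<longleftrightarrow>
     (\<forall>u \<in> {1..n} \<rightarrow>\<^sub>E {0..1}. \<forall>i \<in> {1..n}. mono_on {0..1} (\<lambda>t. P (u(i := t))))"

definition nondecreasing_separable ::
  "nat \<Rightarrow> ((nat \<Rightarrow> 'x) \<Rightarrow> (nat \<Rightarrow> real) \<Rightarrow> real measure) \<Rightarrow> (nat \<Rightarrow> 'x) \<Rightarrow> bool" where
  "nondecreasing_separable n \<pi> x \<longleftrightarrow>
     (\<exists>P. separable_via n \<pi> x P \<and> nondecreasing_coordinatewise n P)"

definition bernoulli :: "real \<Rightarrow> real measure" where
  "bernoulli \<mu> = distr (measure_pmf (bernoulli_pmf (min (max \<mu> 0) 1))) outcome_space of_bool"

definition expected_regret ::
  "real \<Rightarrow> real \<Rightarrow> nat \<Rightarrow> ((nat \<Rightarrow> 'x) \<Rightarrow> (nat \<Rightarrow> real) \<Rightarrow> real measure) \<Rightarrow> (nat \<Rightarrow> 'x)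
    \<Rightarrow> (nat \<Rightarrow> real measure) \<Rightarrow> real measure \<Rightarrow> real" where
  "expected_regret c\<^sub>o c\<^sub>u n \<pi> x F F\<^sub>0 =
     (LINT y|(\<Pi>\<^sub>M i\<in>{1..n}. F i). regret c\<^sub>o c\<^sub>u (\<pi> x y) F\<^sub>0)"

end

theory Submission
  imports Defs
begin

text \<open>Under Bernoulli outcomes every cdf is constant on \<open>[0,1)\<close>, hence by separability so is the cdf of
  the action: the action is almost surely \<open>0\<close> or \<open>1\<close>. The expected regret is therefore affine in the
  probability \<open>P(1 - \<mu>\<^sub>1, \<dots>, 1 - \<mu>\<^sub>n)\<close> of playing \<open>0\<close>, with slope \<open>\<mu>\<^sub>0 - c\<^sub>o\<close>. By monotonicity of \<open>P\<close>,
  the regret is extremal at the extreme means, which the clamping in \<open>\<B>\<close> makes feasible.\<close>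

section \<open>Bernoulli distributions on the outcome space\<close>

lemma space_outcome_space [simp]: "space outcome_space = {0..1}"
  by (simp add: outcome_space_def)

lemma borel_measurable_outcome_space [measurable_dest]:
  "f \<in> borel_measurable borel \<Longrightarrow> f \<in> borel_measurable outcome_space"
  unfolding outcome_space_def by (rule measurable_restrict_space1)

lemma bernoulli_measurable_of_bool [measurable]:
  "of_bool \<in> measurable (measure_pmf p) outcome_space"
  by (auto simp: measurable_def)

lemma prob_space_bernoulli: "prob_space (bernoulli \<mu>)"
  unfolding bernoulli_def
  by (rule prob_space.prob_space_distr[OF prob_space_measure_pmf bernoulli_measurable_of_bool])

lemma sets_bernoulli [measurable_cong, simp]: "sets (bernoulli \<mu>) = sets outcome_space"
  by (simp add: bernoulli_def)

lemma space_bernoulli [simp]: "space (bernoulli \<mu>) = {0..1}"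
  by (simp add: bernoulli_def)

lemma bernoulli_in_distributions: "bernoulli \<mu> \<in> distributions"
  by (simp add: distributions_def space_prob_algebra prob_space_bernoulli)

text \<open>Clamping is idempotent. This lets means outside [0,1] be traded for feasible ones
  without changing the law of the outcomes.\<close>

lemma bernoulli_clamp: "bernoulli (min (max \<mu> 0) 1) = bernoulli \<mu>"
  by (simp add: bernoulli_def)

lemma integral_bernoulli:
  assumes "\<mu> \<in> {0..1}" "f \<in> borel_measurable outcome_space"
  shows "(LINT y|bernoulli \<mu>. f y) = \<mu> * f 1 + (1 - \<mu>) * (f 0 :: real)"
  using assms by (simp add: bernoulli_def integral_distr mult.commute)

text \<open>Of the two atoms only 0 lies below such a \<open>y\<close>. What matters later is that
  the value does not depend on \<open>y\<close>.\<close>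

lemma dist_cdf_bernoulli:
  assumes "\<mu> \<in> {0..1}" "0 \<le> y" "y < 1"
  shows "dist_cdf (bernoulli \<mu>) y = 1 - \<mu>"
proof -
  have S: "{a \<in> {0..1}. a \<le> y} \<in> sets outcome_space"
    unfolding outcome_space_def by (auto simp: sets_restrict_space_iff intro!: borel_closed)
  have "of_bool -` {a \<in> {0..1}. a \<le> y} = {False}"
    using assms by (auto simp: of_bool_def split: if_splits)
  then show ?thesis
    using assms S
    by (simp add: dist_cdf_def, simp add: bernoulli_def measure_distr measure_pmf_single)
qed

text \<open>For an action in [0,1], outcome 1 leaves only the underage term and outcome 0 only the
  overage term.\<close>

lemma expected_loss_bernoulli:
  assumes "\<mu> \<in> {0..1}" "a \<in> {0..1}"
  shows "expected_loss c\<^sub>o c\<^sub>u a (bernoulli \<mu>) = \<mu> * c\<^sub>u * (1 - a) + (1 - \<mu>) * c\<^sub>o * a"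
proof -
  have "newsvendor_loss c\<^sub>o c\<^sub>u a \<in> borel_measurable borel"
    unfolding newsvendor_loss_def by measurable
  from integral_bernoulli[OF assms(1) borel_measurable_outcome_space[OF this]] show ?thesis
    using assms(2) by (simp add: expected_loss_def newsvendor_loss_def)
qed

section \<open>Laws concentrated on the endpoints 0 and 1\<close>

lemma prob_space_measure_eq_imp_AE:
  assumes "prob_space M" "A \<in> sets M" "B \<in> sets M" "A \<subseteq> B" "measure M A = measure M B"
  shows "AE a in M. a \<in> B \<longrightarrow> a \<in> A"
proof -
  interpret prob_space M by fact
  have "prob (B - A) = 0"
    using assms by (simp add: finite_measure_Diff)
  then have "AE a in M. a \<notin> B - A"
    using assms by (subst AE_iff_measurable[of "B - A"])
      (auto simp: emeasure_eq_measure dest: sets.sets_into_space)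
  then show ?thesis by eventually_elim auto
qed

text \<open>A cdf that is flat on [0,1) puts no mass on (0, t] for any t < 1, and countably many
  such intervals cover (0,1).\<close>

lemma AE_zero_or_one:
  assumes N: "prob_space N" "sets N = sets outcome_space"
    and cdf: "\<And>y. 0 \<le> y \<Longrightarrow> y < 1 \<Longrightarrow> dist_cdf N y = dist_cdf N 0"
  shows "AE a in N. a = 0 \<or> a = 1"
proof -
  have sp: "space N = {0..1}"
    using sets_eq_imp_space_eq[OF N(2)] by simp
  have S: "{a \<in> space N. a \<le> y} \<in> sets N" for y
    unfolding N sp outcome_space_def by (auto simp: sets_restrict_space_iff intro!: borel_closed)
  \<comment> \<open>The thresholds start at 0, stay below 1 and tend to 1, so the flatness
    hypothesis applies to each of them and together they reach every point of (0,1).\<close>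
  have "AE a in N. a \<le> 1 - 1 / real (Suc k) \<longrightarrow> a \<le> 0" for k
  proof -
    have "AE a in N. a \<in> {a \<in> space N. a \<le> 1 - 1 / real (Suc k)} \<longrightarrow> a \<in> {a \<in> space N. a \<le> 0}"
    proof (rule prob_space_measure_eq_imp_AE[OF N(1) S S])
      have k: "0 \<le> 1 - 1 / real (Suc k)" "1 - 1 / real (Suc k) < 1" by auto
      show "{a \<in> space N. a \<le> 0} \<subseteq> {a \<in> space N. a \<le> 1 - 1 / real (Suc k)}"
        and "measure N {a \<in> space N. a \<le> 0} = measure N {a \<in> space N. a \<le> 1 - 1 / real (Suc k)}"
        using cdf[OF k] order_trans[OF _ k(1)] by (auto simp: dist_cdf_def simp del: of_nat_Suc)
    qed
    then show ?thesis by (auto elim!: AE_mp intro!: AE_I2)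
  qed
  then have "AE a in N. \<forall>k. a \<le> 1 - 1 / real (Suc k) \<longrightarrow> a \<le> 0"
    unfolding AE_all_countable by blast
  moreover have "AE a in N. a \<in> {0..1}"
    using sp by (auto intro!: AE_I2)
  ultimately show ?thesis
  proof eventually_elim
    case (elim a)
    show ?case
    proof (rule ccontr)
      assume "\<not> (a = 0 \<or> a = 1)"
      with elim have "0 < 1 - a" "0 < a" by auto
      then obtain k where "1 / real (Suc k) < 1 - a"
        using nat_approx_posE by blast
      with elim(1)[rule_format, of k] \<open>0 < a\<close> show False by auto
    qed
  qed
qed

text \<open>On [0,1] the event \<open>a \<le> 0\<close> is the point 0, so
  \<open>dist_cdf N 0\<close> is the mass there and the remaining mass sits at 1.\<close>

lemma integral_zero_one_valued:
  assumes N: "prob_space N" "sets N = sets outcome_space"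
    and AE: "AE a in N. a = 0 \<or> a = 1"
    and f: "f \<in> borel_measurable outcome_space"
  shows "(LINT a|N. f a) = dist_cdf N 0 * f 0 + (1 - dist_cdf N 0) * (f 1 :: real)"
proof -
  interpret prob_space N by fact
  have sp: "space N = {0..1}"
    using sets_eq_imp_space_eq[OF N(2)] by simp
  define A where "A = {a \<in> space N. a \<le> 0}"
  have A: "A \<in> sets N"
    unfolding A_def N sp outcome_space_def
    by (auto simp: sets_restrict_space_iff intro!: borel_closed)
  have [measurable]: "f \<in> borel_measurable N"
    using f by (simp cong: measurable_cong_sets add: N)
  \<comment> \<open>Almost everywhere \<open>f\<close> takes only the values \<open>f 0\<close> on
    \<open>A\<close> and \<open>f 1\<close> off \<open>A\<close>, hence equals a constant plus a
    multiple of an indicator.\<close>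
  have "(LINT a|N. f a) = (LINT a|N. f 1 + (f 0 - f 1) * indicator A a)"
  proof (rule integral_cong_AE)
    show "AE a in N. f a = f 1 + (f 0 - f 1) * indicator A a"
      using AE AE_space by eventually_elim (auto simp: A_def)
  qed (use A in auto)
  also have "\<dots> = f 1 + (f 0 - f 1) * prob A"
    using A by (subst Bochner_Integration.integral_add) (auto simp: prob_space emeasure_eq_measure)
  finally show ?thesis
    by (simp add: A_def dist_cdf_def algebra_simps)
qed

section \<open>Joint monotonicity from coordinatewise monotonicity\<close>

lemma nondecreasing_coordinatewise_imp_mono:
  assumes P: "nondecreasing_coordinatewise n P"
    and u: "u \<in> {1..n} \<rightarrow>\<^sub>E {0..1}" and v: "v \<in> {1..n} \<rightarrow>\<^sub>E {0..1}"
    and le: "\<And>i. i \<in> {1..n} \<Longrightarrow> u i \<le> v i"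
  shows "P u \<le> P v"
proof -
  \<comment> \<open>Coordinates are switched from \<open>u\<close> to \<open>v\<close> one at a
    time: the hybrid vector follows \<open>v\<close> on \<open>K\<close> and \<open>u\<close>
    elsewhere.\<close>
  have "P u \<le> P (override_on u v K)" if "K \<subseteq> {1..n}" for K
  proof -
    have "finite K" using that finite_subset by blast
    then show ?thesis using that
    proof (induction K rule: finite_induct)
      case empty
      show ?case by simp
    next
      case (insert i K)
      let ?w = "override_on u v K"
      have w: "?w \<in> {1..n} \<rightarrow>\<^sub>E {0..1}"
        using u v insert.prems by (auto simp: override_on_def PiE_iff extensional_def)
      have "mono_on {0..1} (\<lambda>t. P (?w(i := t)))"
        using P w insert.prems by (auto simp: nondecreasing_coordinatewise_def)
      then have "P (?w(i := u i)) \<le> P (?w(i := v i))"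
        by (rule mono_onD) (use u v le[of i] insert.prems in \<open>auto simp: PiE_iff\<close>)
      moreover have "?w(i := u i) = ?w"
        using insert.hyps by (auto simp: override_on_def)
      moreover have "?w(i := v i) = override_on u v (insert i K)"
        by (auto simp: override_on_def)
      ultimately show ?case using insert by auto
    qed
  qed
  \<comment> \<open>Outside the index set both vectors are \<open>undefined\<close>, so the last
    hybrid is \<open>v\<close> itself.\<close>
  moreover have "override_on u v {1..n} = v"
    using u v by (auto simp: override_on_def PiE_iff extensional_def fun_eq_iff)
  ultimately show ?thesis by (metis order_refl)
qed

section \<open>Expected regret through the law of the action\<close>

text \<open>Averaging first over the action given the data and then over the data is integration
  against the monadic bind. The bound \<open>B\<close> justifies this exchange and the integrability
  of the inner integral.\<close>

lemma expected_regret_eq_integral_action_law: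
  assumes "policy n \<pi>" "x \<in> {0..n} \<rightarrow>\<^sub>E UNIV"
    and F: "\<And>i. i \<in> {1..n} \<Longrightarrow> F i \<in> distributions"
    and f: "(\<lambda>a. expected_loss c\<^sub>o c\<^sub>u a F\<^sub>0) \<in> borel_measurable outcome_space"
    and B: "\<And>a. a \<in> {0..1} \<Longrightarrow> \<bar>expected_loss c\<^sub>o c\<^sub>u a F\<^sub>0\<bar> \<le> B"
  shows "prob_space (action_law n \<pi> x F)"
    and "sets (action_law n \<pi> x F) = sets outcome_space"
    and "expected_regret c\<^sub>o c\<^sub>u n \<pi> x F F\<^sub>0 =
      (LINT a|action_law n \<pi> x F. expected_loss c\<^sub>o c\<^sub>u a F\<^sub>0)
        - expected_loss c\<^sub>o c\<^sub>u (optimal_action c\<^sub>o c\<^sub>u F\<^sub>0) F\<^sub>0"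
proof -
  let ?M = "\<Pi>\<^sub>M i\<in>{1..n}. F i" and ?f = "\<lambda>a. expected_loss c\<^sub>o c\<^sub>u a F\<^sub>0"
  have setsM: "sets ?M = sets (\<Pi>\<^sub>M i\<in>{1..n}. outcome_space)"
    using F by (intro sets_PiM_cong) (auto simp: distributions_def space_prob_algebra)
  interpret M: prob_space ?M
    using F by (intro prob_space_PiM) (auto simp: distributions_def space_prob_algebra)
  have K: "\<pi> x \<in> ?M \<rightarrow>\<^sub>M prob_algebra outcome_space"
    using assms(1,2) unfolding policy_def measurable_cong_sets[OF setsM refl] by blast
  then have K': "\<pi> x \<in> ?M \<rightarrow>\<^sub>M subprob_algebra outcome_space"
    by (rule measurable_prob_algebraD)
  \<comment> \<open>The rules for \<open>bind\<close> take the initial law as a point of a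
    \<open>prob_algebra\<close>; here \<open>?M\<close> is a point of its own.\<close>
  have M: "?M \<in> space (prob_algebra ?M)"
    using M.prob_space_axioms unfolding space_prob_algebra by blast
  show "prob_space (action_law n \<pi> x F)"
    and "sets (action_law n \<pi> x F) = sets outcome_space"
    using prob_space_bind'[OF M K] sets_bind'[OF M K] by (simp_all add: action_law_def)
  have kernel: "prob_space (\<pi> x y)" "space (\<pi> x y) = {0..1}" if "y \<in> space ?M" for y
    using measurable_space[OF K that] sets_eq_imp_space_eq[of "\<pi> x y" outcome_space]
    by (simp_all add: space_prob_algebra)
  \<comment> \<open>The constant 1 bounds the total mass of each kernel measure.\<close>
  have bind: "(LINT a|(?M \<bind> \<pi> x). ?f a) = (LINT y|?M. (LINT a|\<pi> x y. ?f a))"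
    by (rule integral_bind[OF f _ K' M.finite_measure_axioms, of B 1])
      (use B kernel(1) in \<open>auto intro!: AE_I2 simp: prob_space.emeasure_space_1\<close>)
  \<comment> \<open>Integrability is what allows the constant optimal loss to be split off from the
    integral over the data.\<close>
  have int: "integrable ?M (\<lambda>y. LINT a|\<pi> x y. ?f a)"
  proof (rule M.integrable_const_bound[of _ B])
    show "AE y in ?M. norm (LINT a|\<pi> x y. ?f a) \<le> B"
    proof (rule AE_I2)
      fix y assume y: "y \<in> space ?M"
      interpret K: prob_space "\<pi> x y" by (rule kernel[OF y])
      have "?f \<in> borel_measurable (\<pi> x y)"
        using f subprob_measurableD(2)[OF K' y] by (simp cong: measurable_cong_sets)
      then have "integrable (\<pi> x y) ?f"
        by (intro K.integrable_const_bound[of _ B]) (use kernel(2)[OF y] B in auto)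
      then have "norm (LINT a|\<pi> x y. ?f a) \<le> (LINT a|\<pi> x y. B)"
        by (intro Bochner_Integration.integral_norm_bound_integral) (use kernel(2)[OF y] B in auto)
      then show "norm (LINT a|\<pi> x y. ?f a) \<le> B"
        by (simp add: K.prob_space)
    qed
    show "(\<lambda>y. LINT a|\<pi> x y. ?f a) \<in> borel_measurable ?M"
      using integral_measurable_subprob_algebra[OF f] K' by (rule measurable_compose[rotated])
  qed
  show "expected_regret c\<^sub>o c\<^sub>u n \<pi> x F F\<^sub>0 =
      (LINT a|action_law n \<pi> x F. ?f a) - expected_loss c\<^sub>o c\<^sub>u (optimal_action c\<^sub>o c\<^sub>u F\<^sub>0) F\<^sub>0"
    unfolding expected_regret_def regret_def randomized_loss_def action_law_def bind
      Bochner_Integration.integral_diff[OF int M.integrable_const]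
    by (simp only: lebesgue_integral_const M.prob_space scaleR_one)
qed

text \<open>Playing 0 costs \<open>\<mu>\<^sub>0 * c\<^sub>u\<close> and playing 1 costs
  \<open>(1 - \<mu>\<^sub>0) * c\<^sub>o\<close>; since the costs sum to 1, the difference is
  \<open>\<mu>\<^sub>0 - c\<^sub>o\<close>. The means enter only through the value of
  \<open>P\<close>.\<close>

lemma expected_regret_bernoulli:
  assumes "c\<^sub>o + c\<^sub>u = 1" "policy n \<pi>" "x \<in> {0..n} \<rightarrow>\<^sub>E UNIV"
    and P: "separable_via n \<pi> x P" and \<mu>: "\<mu> \<in> {1..n} \<rightarrow> {0..1}" and \<mu>0: "\<mu>\<^sub>0 \<in> {0..1}"
  shows "expected_regret c\<^sub>o c\<^sub>u n \<pi> x (\<lambda>i. bernoulli (\<mu> i)) (bernoulli \<mu>\<^sub>0) =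
    (\<mu>\<^sub>0 - c\<^sub>o) * P (\<lambda>i\<in>{1..n}. 1 - \<mu> i) + (1 - \<mu>\<^sub>0) * c\<^sub>o
      - expected_loss c\<^sub>o c\<^sub>u (optimal_action c\<^sub>o c\<^sub>u (bernoulli \<mu>\<^sub>0)) (bernoulli \<mu>\<^sub>0)"
proof -
  let ?F = "\<lambda>i. bernoulli (\<mu> i)" and ?f = "\<lambda>a. expected_loss c\<^sub>o c\<^sub>u a (bernoulli \<mu>\<^sub>0)"
  let ?N = "action_law n \<pi> x ?F"
  have f: "?f \<in> borel_measurable outcome_space"
    by (subst measurable_cong[OF expected_loss_bernoulli[OF \<mu>0]])
      (auto intro!: borel_measurable_outcome_space)
  have B: "\<bar>?f a\<bar> \<le> \<bar>c\<^sub>u\<bar> + \<bar>c\<^sub>o\<bar>" if a: "a \<in> {0..1}" for a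
  proof -
    have "\<bar>\<mu>\<^sub>0\<bar> * \<bar>c\<^sub>u\<bar> * \<bar>1 - a\<bar> \<le> 1 * \<bar>c\<^sub>u\<bar> * 1" "\<bar>1 - \<mu>\<^sub>0\<bar> * \<bar>c\<^sub>o\<bar> * \<bar>a\<bar> \<le> 1 * \<bar>c\<^sub>o\<bar> * 1"
      by (intro mult_mono; use a \<mu>0 in simp)+
    then have "\<bar>\<mu>\<^sub>0 * c\<^sub>u * (1 - a)\<bar> \<le> \<bar>c\<^sub>u\<bar>" "\<bar>(1 - \<mu>\<^sub>0) * c\<^sub>o * a\<bar> \<le> \<bar>c\<^sub>o\<bar>"
      by (simp_all add: abs_mult)
    then show ?thesis
      unfolding expected_loss_bernoulli[OF \<mu>0 a] by linarith
  qed
  have cu: "c\<^sub>u = 1 - c\<^sub>o"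
    using assms(1) by simp
  have law: "prob_space ?N" "sets ?N = sets outcome_space"
    "expected_regret c\<^sub>o c\<^sub>u n \<pi> x ?F (bernoulli \<mu>\<^sub>0) =
      (LINT a|?N. ?f a)
        - expected_loss c\<^sub>o c\<^sub>u (optimal_action c\<^sub>o c\<^sub>u (bernoulli \<mu>\<^sub>0)) (bernoulli \<mu>\<^sub>0)"
    by (rule expected_regret_eq_integral_action_law[OF assms(2,3) bernoulli_in_distributions f B];
        assumption)+
  have cdf: "dist_cdf ?N y = P (\<lambda>i\<in>{1..n}. 1 - \<mu> i)" if "0 \<le> y" "y < 1" for y
  proof -
    \<comment> \<open>Separability speaks of extensional families, so the family is first
      restricted; the product sees only the indices in \<open>{1..n}\<close>.\<close>
    have "?N = action_law n \<pi> x (\<lambda>i\<in>{1..n}. ?F i)"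
      unfolding action_law_def by (intro arg_cong2[where f = bind] PiM_cong) simp_all
    moreover have "(\<lambda>i\<in>{1..n}. ?F i) \<in> {1..n} \<rightarrow>\<^sub>E distributions"
      by (auto simp: bernoulli_in_distributions)
    ultimately have "dist_cdf ?N y = P (\<lambda>i\<in>{1..n}. dist_cdf ((\<lambda>i\<in>{1..n}. ?F i) i) y)"
      using P unfolding separable_via_def by metis
    also have "(\<lambda>i\<in>{1..n}. dist_cdf ((\<lambda>i\<in>{1..n}. ?F i) i) y) = (\<lambda>i\<in>{1..n}. 1 - \<mu> i)"
      using that \<mu> by (intro restrict_ext) (auto simp: dist_cdf_bernoulli Pi_iff)
    finally show ?thesis .
  qed
  have "AE a in ?N. a = 0 \<or> a = 1"
    by (rule AE_zero_or_one[OF law(1,2)]) (auto simp: cdf)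
  then have "(LINT a|?N. ?f a) =
      P (\<lambda>i\<in>{1..n}. 1 - \<mu> i) * ?f 0 + (1 - P (\<lambda>i\<in>{1..n}. 1 - \<mu> i)) * ?f 1"
    using integral_zero_one_valued[OF law(1,2) _ f] by (simp add: cdf)
  also have "\<dots> = P (\<lambda>i\<in>{1..n}. 1 - \<mu> i) * (\<mu>\<^sub>0 * c\<^sub>u)
      + (1 - P (\<lambda>i\<in>{1..n}. 1 - \<mu> i)) * ((1 - \<mu>\<^sub>0) * c\<^sub>o)"
    using \<mu>0 by (simp add: expected_loss_bernoulli)
  also have "\<dots> = (\<mu>\<^sub>0 - c\<^sub>o) * P (\<lambda>i\<in>{1..n}. 1 - \<mu> i) + (1 - \<mu>\<^sub>0) * c\<^sub>o"
    unfolding cu by (simp add: algebra_simps)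
  finally show ?thesis
    unfolding law(3) by simp
qed

theorem proposition2:
  fixes d :: "'x \<Rightarrow> 'x \<Rightarrow> real"
    and c\<^sub>o c\<^sub>u \<mu>\<^sub>0 :: real
    and n :: nat
    and x :: "nat \<Rightarrow> 'x"
    and \<pi> :: "(nat \<Rightarrow> 'x) \<Rightarrow> (nat \<Rightarrow> real) \<Rightarrow> real measure"
  assumes "\<And>u v. d u v \<ge> 0"
    and "c\<^sub>o > 0" and "c\<^sub>u > 0" and "c\<^sub>o + c\<^sub>u = 1"
    and "n \<ge> 1"
    and "x \<in> {0..n} \<rightarrow>\<^sub>E UNIV"
    and "policy n \<pi>"
    and "nondecreasing_separable n \<pi> x"
    and "\<mu>\<^sub>0 \<in> {0..1}"
  shows "(\<mu>\<^sub>0 \<in> {0..1 - critical_ratio c\<^sub>o c\<^sub>u} \<longrightarrow>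
      (SUP \<mu> \<in> {\<mu> \<in> {1..n} \<rightarrow>\<^sub>E {0..1}. \<forall>i\<in>{1..n}. \<bar>\<mu> i - \<mu>\<^sub>0\<bar> \<le> d (x 0) (x i)}.
         ereal (expected_regret c\<^sub>o c\<^sub>u n \<pi> x (\<lambda>i. bernoulli (\<mu> i)) (bernoulli \<mu>\<^sub>0)))
      = ereal (expected_regret c\<^sub>o c\<^sub>u n \<pi> x (\<lambda>i. bernoulli (\<mu>\<^sub>0 + d (x 0) (x i))) (bernoulli \<mu>\<^sub>0))) \<and>
    (\<mu>\<^sub>0 \<in> {1 - critical_ratio c\<^sub>o c\<^sub>u..1} \<longrightarrow>
      (SUP \<mu> \<in> {\<mu> \<in> {1..n} \<rightarrow>\<^sub>E {0..1}. \<forall>i\<in>{1..n}. \<bar>\<mu> i - \<mu>\<^sub>0\<bar> \<le> d (x 0) (x i)}.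
         ereal (expected_regret c\<^sub>o c\<^sub>u n \<pi> x (\<lambda>i. bernoulli (\<mu> i)) (bernoulli \<mu>\<^sub>0)))
      = ereal (expected_regret c\<^sub>o c\<^sub>u n \<pi> x (\<lambda>i. bernoulli (\<mu>\<^sub>0 - d (x 0) (x i))) (bernoulli \<mu>\<^sub>0)))"
proof -
  let ?D = "{\<mu> \<in> {1..n} \<rightarrow>\<^sub>E {0..1}. \<forall>i\<in>{1..n}. \<bar>\<mu> i - \<mu>\<^sub>0\<bar> \<le> d (x 0) (x i)}"
  let ?R = "\<lambda>\<mu>. expected_regret c\<^sub>o c\<^sub>u n \<pi> x (\<lambda>i. bernoulli (\<mu> i)) (bernoulli \<mu>\<^sub>0)"
  obtain P where P: "separable_via n \<pi> x P" "nondecreasing_coordinatewise n P"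
    using assms(8) by (auto simp: nondecreasing_separable_def)
  \<comment> \<open>The threshold in the theorem is exactly where the slope
    \<open>\<mu>\<^sub>0 - c\<^sub>o\<close> changes sign.\<close>
  have q: "1 - critical_ratio c\<^sub>o c\<^sub>u = c\<^sub>o"
    using assms(4) by (simp add: critical_ratio_def add.commute)
  note R = expected_regret_bernoulli[OF assms(4,7,6) P(1) _ assms(9)]
  \<comment> \<open>The order reverses: larger means give smaller cdf values on [0,1), hence a
    smaller probability of playing 0.\<close>
  have mono: "P (\<lambda>i\<in>{1..n}. 1 - \<nu> i) \<le> P (\<lambda>i\<in>{1..n}. 1 - \<mu> i)"
    if "\<mu> \<in> {1..n} \<rightarrow>\<^sub>E {0..1}" "\<nu> \<in> {1..n} \<rightarrow>\<^sub>E {0..1}" "\<And>i. i \<in> {1..n} \<Longrightarrow> \<mu> i \<le> \<nu> i" for \<mu> \<nu>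
    by (rule nondecreasing_coordinatewise_imp_mono[OF P(2)])
      (use that in \<open>auto simp: PiE_iff\<close>)
  \<comment> \<open>Shared by both cases: a feasible clamped vector that dominates attains the
    supremum, and the unclamped means \<open>m\<close> induce the same product law.\<close>
  have SUP: "(SUP \<mu>\<in>?D. ereal (?R \<mu>)) = ereal (?R m)"
    if "\<nu> = (\<lambda>i\<in>{1..n}. min (max (m i) 0) 1)" "\<nu> \<in> ?D" "\<And>\<mu>. \<mu> \<in> ?D \<Longrightarrow> ?R \<mu> \<le> ?R \<nu>" for m \<nu>
  proof -
    have "(\<Pi>\<^sub>M i\<in>{1..n}. bernoulli (\<nu> i)) = (\<Pi>\<^sub>M i\<in>{1..n}. bernoulli (m i))"
      unfolding that(1) by (intro PiM_cong) (simp_all add: bernoulli_clamp)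
    then have "?R m = ?R \<nu>"
      by (simp add: expected_regret_def)
    then show ?thesis
      using that(2,3) by (intro antisym SUP_least) (auto intro: SUP_upper2)
  qed
  let ?up = "\<lambda>i\<in>{1..n}. min (max (\<mu>\<^sub>0 + d (x 0) (x i)) 0) 1"
  let ?lo = "\<lambda>i\<in>{1..n}. min (max (\<mu>\<^sub>0 - d (x 0) (x i)) 0) 1"
  \<comment> \<open>Since \<open>\<mu>\<^sub>0\<close> lies in [0,1], clamping to [0,1] never moves
    a point away from it, so the clamped extremes respect the distance constraints.\<close>
  have "\<bar>min (max (\<mu>\<^sub>0 + t) 0) 1 - \<mu>\<^sub>0\<bar> \<le> t" "\<bar>min (max (\<mu>\<^sub>0 - t) 0) 1 - \<mu>\<^sub>0\<bar> \<le> t" if "0 \<le> t" for t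
    using that assms(9) by (auto simp: min_def max_def)
  then have up: "?up \<in> ?D" and lo: "?lo \<in> ?D"
    using assms(1) by (auto simp: PiE_iff)
  \<comment> \<open>Thus \<open>?up\<close> and \<open>?lo\<close> are the coordinatewise greatest
    and least elements of \<open>?D\<close>.\<close>
  have up_ge: "\<mu> i \<le> ?up i" and lo_le: "?lo i \<le> \<mu> i" if "\<mu> \<in> ?D" "i \<in> {1..n}" for \<mu> i
  proof -
    have "0 \<le> \<mu> i" "\<mu> i \<le> 1" "\<bar>\<mu> i - \<mu>\<^sub>0\<bar> \<le> d (x 0) (x i)"
      using that by (auto simp: PiE_iff)
    then show "\<mu> i \<le> ?up i" "?lo i \<le> \<mu> i"
      using that(2) by (auto simp: min_def max_def)
  qed
  show ?thesis
    unfolding q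
  proof (intro conjI impI)
    assume "\<mu>\<^sub>0 \<in> {0..c\<^sub>o}"
    \<comment> \<open>With a nonpositive slope the regret is largest where \<open>P\<close> is
      smallest, that is, at the greatest means.\<close>
    then have c: "\<mu>\<^sub>0 - c\<^sub>o \<le> 0" by simp
    show "(SUP \<mu>\<in>?D. ereal (?R \<mu>)) = ereal (?R (\<lambda>i. \<mu>\<^sub>0 + d (x 0) (x i)))"
    proof (rule SUP[OF refl up])
      fix \<mu> assume \<mu>: "\<mu> \<in> ?D"
      then have "P (\<lambda>i\<in>{1..n}. 1 - ?up i) \<le> P (\<lambda>i\<in>{1..n}. 1 - \<mu> i)"
        by (intro mono up_ge) (use up in blast)+
      then have "(\<mu>\<^sub>0 - c\<^sub>o) * P (\<lambda>i\<in>{1..n}. 1 - \<mu> i) \<le> (\<mu>\<^sub>0 - c\<^sub>o) * P (\<lambda>i\<in>{1..n}. 1 - ?up i)"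
        using c by (rule mult_left_mono_neg)
      moreover have "\<mu> \<in> {1..n} \<rightarrow> {0..1}" "?up \<in> {1..n} \<rightarrow> {0..1}"
        using \<mu> by (auto simp: PiE_iff)
      ultimately show "?R \<mu> \<le> ?R ?up"
        using R[of \<mu>] R[of ?up] by linarith
    qed
  next
    assume "\<mu>\<^sub>0 \<in> {c\<^sub>o..1}"
    \<comment> \<open>With a nonnegative slope the regret is largest where \<open>P\<close> is
      largest, that is, at the least means.\<close>
    then have c: "0 \<le> \<mu>\<^sub>0 - c\<^sub>o" by simp
    show "(SUP \<mu>\<in>?D. ereal (?R \<mu>)) = ereal (?R (\<lambda>i. \<mu>\<^sub>0 - d (x 0) (x i)))"
    proof (rule SUP[OF refl lo])
      fix \<mu> assume \<mu>: "\<mu> \<in> ?D"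
      then have "P (\<lambda>i\<in>{1..n}. 1 - \<mu> i) \<le> P (\<lambda>i\<in>{1..n}. 1 - ?lo i)"
        by (intro mono lo_le) (use lo in blast)+
      then have "(\<mu>\<^sub>0 - c\<^sub>o) * P (\<lambda>i\<in>{1..n}. 1 - \<mu> i) \<le> (\<mu>\<^sub>0 - c\<^sub>o) * P (\<lambda>i\<in>{1..n}. 1 - ?lo i)"
        using c by (rule mult_left_mono)
      moreover have "\<mu> \<in> {1..n} \<rightarrow> {0..1}" "?lo \<in> {1..n} \<rightarrow> {0..1}"
        using \<mu> by (auto simp: PiE_iff)
      ultimately show "?R \<mu> \<le> ?R ?lo"
        using R[of \<mu>] R[of ?lo] by linarith
    qed
  qed
qed

end
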